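(* Let $f:\{0,1\}^n\to\mathbb{R}$ be an arbitrary function, and let $\mathcal{K}$ be a maximal $\{0,1\}^n$-free set in $\mathbb{R}^n$. Then $\mathcal{C}:=\mathcal{K}\times\mathbb{R}$ is a maximal $\mathrm{hypo}(f)$-free set in $\mathbb{R}^{n+1}$, where $\mathrm{hypo}(f):=\{(x,t)\in\{0,1\}^n\times\mathbb{R}: f(x)\ge t\}$.
   Context: For a set $\mathcal{S}\subseteq\mathbb{R}^p$, a closed convex set $\mathcal{C}\subseteq\mathbb{R}^p$ is called $\mathcal{S}$-free if $\mathrm{int}(\mathcal{C})\cap\mathcal{S}=\varnothing$. It is a maximal $\mathcal{S}$-free set if it is not properly contained in another $\mathcal{S}$-free set. *)

theory Defs
  imports "HOL-Analysis.Analysis"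
begin

definition S_free :: "'a::euclidean_space set \<Rightarrow> 'a set \<Rightarrow> bool" where
  "S_free S C \<longleftrightarrow> closed C \<and> convex C \<and> interior C \<inter> S = {}"

definition maximal_S_free :: "'a::euclidean_space set \<Rightarrow> 'a set \<Rightarrow> bool" where
  "maximal_S_free S C \<longleftrightarrow> S_free S C \<and> \<not> (\<exists>D. S_free S D \<and> C \<subset> D)"

definition binary_points :: "(real ^ 'n) set" where
  "binary_points = {x. \<forall>i. x $ i \<in> {0, 1}}"

(* A function on the binary points is represented by a total function on real ^ 'n;
   its values elsewhere are irrelevant. The ambient space R^(n+1) is (real ^ 'n) \<times> real. *)
definition hypo :: "(real ^ 'n \<Rightarrow> real) \<Rightarrow> ((real ^ 'n) \<times> real) set" where
  "hypo f = {(x, t). x \<in> binary_points \<and> f x \<ge> t}"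

end

theory Submission
  imports Defs
begin

text \<open>
  A maximal \<open>{0,1}\<^sup>n\<close>-free set \<open>K\<close> is nonempty, so every closed convex \<open>D \<supseteq> K \<times> \<real>\<close>
  contains a vertical line. A closed convex set that contains one line contains the parallel line
  through each of its points; hence \<open>D\<close> is itself a cylinder \<open>E \<times> \<real>\<close> (lemma
  \<open>closed_convex_vertical_line_imp_cylinder\<close>). For cylinders, freeness descends to the base: the
  interior of \<open>E \<times> \<real>\<close> is \<open>interior E \<times> \<real>\<close>, and \<open>hypo f\<close> lies over exactly the binary points
  (lemma \<open>S_free_hypo_cylinder_iff\<close>). So enlarging \<open>K \<times> \<real>\<close> within the
  \<open>hypo f\<close>-free sets amounts to enlarging \<open>K\<close> within the \<open>{0,1}\<^sup>n\<close>-free sets.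
\<close>

text \<open>
  The point \<open>(x, s)\<close> is approached from within \<open>D\<close> along segments from \<open>(x, t)\<close> to points of the
  line over \<open>a\<close> that move off to infinity: the weight of the far endpoint tends to \<open>0\<close>, which
  removes the contribution of \<open>a\<close>, while its height compensates for the weight.
\<close>

lemma closed_convex_vertical_line_translate:
  fixes D :: "('a::real_normed_vector \<times> real) set"
  assumes "closed D" and "convex D"
    and line: "\<And>r. (a, r) \<in> D" and "(x, t) \<in> D"
  shows "(x, s) \<in> D"
proof -
  define e :: "nat \<Rightarrow> real" where "e k = inverse (real (Suc k))" for k
  define p where "p k = ((1 - e k) *\<^sub>R x + e k *\<^sub>R a, s)" for k
  have "p k \<in> D" for k
  proof -
    have e: "0 < e k" "e k \<le> 1"
      by (auto simp: e_def field_simps)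
    have "(1 - e k) *\<^sub>R (x, t) + e k *\<^sub>R (a, t + (s - t) / e k) \<in> D"
      using e by (intro convexD[OF \<open>convex D\<close> \<open>(x, t) \<in> D\<close> line]) auto
    moreover have "(1 - e k) *\<^sub>R (x, t) + e k *\<^sub>R (a, t + (s - t) / e k) = p k"
      using e by (simp add: p_def field_simps)
    ultimately show ?thesis by simp
  qed
  moreover have "e \<longlonglongrightarrow> 0"
    unfolding e_def by (rule LIMSEQ_inverse_real_of_nat)
  then have "p \<longlonglongrightarrow> ((1 - 0) *\<^sub>R x + 0 *\<^sub>R a, s)"
    unfolding p_def by (intro tendsto_intros)
  ultimately show ?thesis
    using closed_sequentially[OF \<open>closed D\<close>] by force
qed

lemma closed_convex_vertical_line_imp_cylinder:
  fixes D :: "('a::real_normed_vector \<times> real) set"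
  assumes "closed D" and "convex D" and "\<And>r. (a, r) \<in> D"
  shows "D = fst ` D \<times> UNIV"
  using closed_convex_vertical_line_translate[OF assms] by force

text \<open>
  The interior of a cylinder contains either all or none of a vertical line, so whether it meets
  \<open>hypo f\<close> depends only on the projection of \<open>hypo f\<close> to the base, which is \<open>binary_points\<close>.
\<close>

lemma S_free_hypo_cylinder_iff:
  fixes E :: "(real ^ 'n) set"
  shows "S_free (hypo f) (E \<times> (UNIV :: real set)) \<longleftrightarrow> S_free binary_points E"
proof -
  have "interior (E \<times> (UNIV :: real set)) \<inter> hypo f = {} \<longleftrightarrow> interior E \<inter> binary_points = {}"
    by (auto simp: interior_Times hypo_def)
  moreover have "closed (E \<times> (UNIV :: real set)) \<longleftrightarrow> closed E"
  proof
    assume "closed (E \<times> (UNIV :: real set))"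
    then have "closed ((\<lambda>x. (x, 0 :: real)) -` (E \<times> UNIV))"
      by (intro closed_vimage continuous_intros)
    then show "closed E" by (simp add: vimage_def)
  qed (simp add: closed_Times)
  moreover have "convex (E \<times> (UNIV :: real set)) \<longleftrightarrow> convex E"
  proof
    assume "convex (E \<times> (UNIV :: real set))"
    then have "convex (fst ` (E \<times> (UNIV :: real set)))"
      by (rule convex_linear_image[OF linear_fst])
    then show "convex E" by simp
  qed (simp add: convex_Times)
  ultimately show ?thesis
    by (simp add: S_free_def)
qed

text \<open>
  The empty set is free but not maximal, since a single point has empty interior in positive
  dimension.
\<close>

lemma maximal_S_free_nonempty:
  assumes "maximal_S_free S K"
  shows "K \<noteq> {}"
proof
  assume "K = {}"
  moreover have "S_free S {0}"
    by (simp add: S_free_def)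
  ultimately show False
    using assms by (auto simp: maximal_S_free_def)
qed

theorem theorem2:
  fixes f :: "real ^ 'n \<Rightarrow> real" and K :: "(real ^ 'n) set"
  assumes "maximal_S_free binary_points K"
  shows "maximal_S_free (hypo f) (K \<times> (UNIV :: real set))"
proof -
  have free: "S_free (hypo f) (K \<times> (UNIV :: real set))"
    using assms by (simp add: S_free_hypo_cylinder_iff maximal_S_free_def)
  have False if D: "S_free (hypo f) D" and sub: "K \<times> (UNIV :: real set) \<subset> D" for D
  proof -
    obtain a where "a \<in> K"
      using maximal_S_free_nonempty[OF assms] by blast
    then have cyl: "D = fst ` D \<times> UNIV"
      using D sub by (intro closed_convex_vertical_line_imp_cylinder[of D a])
        (auto simp: S_free_def)
    have "S_free binary_points (fst ` D)"
      using D cyl S_free_hypo_cylinder_iff by metis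
    moreover have "K \<subset> fst ` D"
      using sub cyl by blast
    ultimately show False
      using assms by (auto simp: maximal_S_free_def)
  qed
  with free show ?thesis
    by (auto simp: maximal_S_free_def)
qed

end
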